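(* Let $(\gamma,\nu_1,\nu_2):I\to\mathbb{R}^3\times\Delta$ be a framed curve with curvature $(\ell,m,n,\alpha)$. (1) Suppose that there exists the framed curve $\mathcal{I}(\gamma,\nu_1,\nu_2):I\to\mathbb{R}^3\times\Delta$, where $(\lambda^{\mathcal I},\eta^{\mathcal I}):I\to\mathbb{R}^2$ is a smooth map such that $$-\lambda^{\mathcal I}m+\dot\eta^{\mathcal I}=0,\qquad \alpha+\dot\lambda^{\mathcal I}+\eta^{\mathcal I}m=0$$ on $I$ and $\theta^{\mathcal I}:I\to\mathbb{R}$ is a smooth function. If we take $$\lambda^{\mathcal E}=-\lambda^{\mathcal I}\cos\theta^{\mathcal I}+\eta^{\mathcal I}\sin\theta^{\mathcal I},\qquad \eta^{\mathcal E}=-\lambda^{\mathcal I}\sin\theta^{\mathcal I}-\eta^{\mathcal I}\cos\theta^{\mathcal I},\qquad \theta^{\mathcal E}=-\theta^{\mathcal I},$$ then the evolute of the involute $\mathcal{E}v(\mathcal{I}(\gamma,\nu_1,\nu_2))$ exists. Moreover, we have $\mathcal{E}(\mathcal{I}(\gamma,\nu_1,\nu_2))=(\gamma,\nu_1,\nu_2)$. (2) Suppose that there exists the framed curve $\mathcal{E}(\gamma,\nu_1,\nu_2):I\to\mathbb{R}^3\times\Delta$, where $(\lambda^{\mathcal E},\eta^{\mathcal E}):I\to\mathbb{R}^2$ is a smooth map and $\theta^{\mathcal E}:I\to\mathbb{R}$ is a smooth function such that $$\alpha+\lambda^{\mathcal E}m+\eta^{\mathcal E}n=0,\qquad (\dot\lambda^{\mathcal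 E}-\eta^{\mathcal E}\ell)\sin\theta^{\mathcal E}+(\lambda^{\mathcal E}\ell+\dot\eta^{\mathcal E})\cos\theta^{\mathcal E}=0$$ on $I$. If we take $$\lambda^{\mathcal I}=-\lambda^{\mathcal E}\cos\theta^{\mathcal E}+\eta^{\mathcal E}\sin\theta^{\mathcal E},\qquad \eta^{\mathcal I}=-\lambda^{\mathcal E}\sin\theta^{\mathcal E}-\eta^{\mathcal E}\cos\theta^{\mathcal E},$$ then the involute of the evolute $\mathcal{I}nv(\mathcal{E}(\gamma,\nu_1,\nu_2))$ exists. Moreover, if we take $\theta^{\mathcal I}=-\theta^{\mathcal E}$, then we have $\mathcal{I}(\mathcal{E}(\gamma,\nu_1,\nu_2))=(\gamma,\nu_1,\nu_2)$.
   Context: All maps are $C^\infty$; $I\subset\mathbb{R}$ is an interval. Let $\Delta=\{(a,b)\in S^2\times S^2\mid a\cdot b=0\}$. A smooth map $(\gamma,\nu_1,\nu_2):I\to\mathbb{R}^3\times\Delta$ is a framed curve if $\dot\gamma\cdot\nu_1=\dot\gamma\cdot\nu_2=0$ on $I$. Put $\mu=\nu_1\times\nu_2$. The curvature $(\ell,m,n,\alpha)$ is $\ell=\dot\nu_1\cdot\nu_2$, $m=\dot\nu_1\cdot\mu$, $n=\dot\nu_2\cdot\mu$, $\alpha=\dot\gamma\cdot\mu$. Evolute: given a smooth map $(\lambda^{\mathcal E},\eta^{\mathcal E}):I\to\mathbb{R}^2$ and a smooth function $\theta^{\mathcal E}:I\to\mathbb{R}$ satisfying the evolute condition $$\alpha+\lambda^{\mathcal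 E}m+\eta^{\mathcal E}n=0,\qquad (\dot\lambda^{\mathcal E}-\eta^{\mathcal E}\ell)\sin\theta^{\mathcal E}+(\lambda^{\mathcal E}\ell+\dot\eta^{\mathcal E})\cos\theta^{\mathcal E}=0$$ on $I$, the framed curve $\mathcal{E}(\gamma,\nu_1,\nu_2)=(\mathcal{E}v(\gamma,\nu_1,\nu_2),\nu_1^{\mathcal E},\nu_2^{\mathcal E})$ is defined by $\mathcal{E}v(\gamma,\nu_1,\nu_2)=\gamma+\lambda^{\mathcal E}\nu_1+\eta^{\mathcal E}\nu_2$, $\nu_1^{\mathcal E}=\sin\theta^{\mathcal E}\nu_1+\cos\theta^{\mathcal E}\nu_2$, $\nu_2^{\mathcal E}=\mu$. Involute: given a smooth map $(\lambda^{\mathcal I},\eta^{\mathcal I}):I\to\mathbb{R}^2$ satisfying the involute condition $$-\lambda^{\mathcal I}m+\dot\eta^{\mathcal I}=0,\qquad \alpha+\dot\lambda^{\mathcal I}+\eta^{\mathcal I}m=0$$ on $I$ and an arbitrary smooth function $\theta^{\mathcal I}:I\to\mathbb{R}$, the framed curve $\mathcal{I}(\gamma,\nu_1,\nu_2)=(\mathcal{I}nv(\gamma,\nu_1,\nu_2),\nu_1^{\mathcal I},\nu_2^{\mathcal I})$ is defined by $\mathcal{I}nv(\gamma,\nu_1,\nu_2)=\gamma+\lambda^{\mathcal I}\mu+\eta^{\mathcal I}\nu_1$, $\nu_1^{\mathcal I}=\cos\theta^{\mathcal I}\mu-\sin\theta^{\mathcal I}\nu_1$, $\nu_2^{\mathcal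 I}=\sin\theta^{\mathcal I}\mu+\cos\theta^{\mathcal I}\nu_1$. $\mathcal{E}(\mathcal{I}(\gamma,\nu_1,\nu_2))$ and $\mathcal{I}(\mathcal{E}(\gamma,\nu_1,\nu_2))$ are obtained by applying these definitions to the framed curves $\mathcal{I}(\gamma,\nu_1,\nu_2)$ and $\mathcal{E}(\gamma,\nu_1,\nu_2)$, respectively (with their own frames and curvatures); "exists" means that the evolute (respectively, involute) condition, written with the curvature of that framed curve, is satisfied by the chosen functions. *)

theory Defs
  imports "HOL-Analysis.Analysis"
begin

(* Derivative relative to I: one-sided at an endpoint of I that belongs to I.
   It is meaningful only at points of I, for I a nondegenerate interval; nothing below
   evaluates it elsewhere. *)
definition deriv_on :: "real set \<Rightarrow> (real \<Rightarrow> 'a::real_normed_vector) \<Rightarrow> real \<Rightarrow> 'a" where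
  "deriv_on I f t = vector_derivative f (at t within I)"

definition smooth_on :: "real set \<Rightarrow> (real \<Rightarrow> 'a::real_normed_vector) \<Rightarrow> bool" where
  "smooth_on I f \<longleftrightarrow> (\<forall>k. \<forall>t\<in>I. ((deriv_on I ^^ k) f) differentiable (at t within I))"

definition Delta :: "((real^3) \<times> (real^3)) set" where
  "Delta = {(a, b). a \<in> sphere 0 1 \<and> b \<in> sphere 0 1 \<and> a \<bullet> b = 0}"

(* A map t |-> (gamma t, nu1 t, nu2 t); only its values on the parameter interval matter. *)
type_synonym frame_map = "real \<Rightarrow> (real^3) \<times> (real^3) \<times> (real^3)"

definition gam :: "frame_map \<Rightarrow> real \<Rightarrow> real^3" where
  "gam F t = fst (F t)"

definition nu1 :: "frame_map \<Rightarrow> real \<Rightarrow> real^3" where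
  "nu1 F t = fst (snd (F t))"

definition nu2 :: "frame_map \<Rightarrow> real \<Rightarrow> real^3" where
  "nu2 F t = snd (snd (F t))"

definition mu :: "frame_map \<Rightarrow> real \<Rightarrow> real^3" where
  "mu F t = cross3 (nu1 F t) (nu2 F t)"

definition framed_curve :: "real set \<Rightarrow> frame_map \<Rightarrow> bool" where
  "framed_curve I F \<longleftrightarrow>
     smooth_on I F \<and> (\<forall>t\<in>I. F t \<in> UNIV \<times> Delta) \<and>
     (\<forall>t\<in>I. deriv_on I (gam F) t \<bullet> nu1 F t = 0 \<and> deriv_on I (gam F) t \<bullet> nu2 F t = 0)"

definition curv_l :: "real set \<Rightarrow> frame_map \<Rightarrow> real \<Rightarrow> real" where
  "curv_l I F t = deriv_on I (nu1 F) t \<bullet> nu2 F t"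

definition curv_m :: "real set \<Rightarrow> frame_map \<Rightarrow> real \<Rightarrow> real" where
  "curv_m I F t = deriv_on I (nu1 F) t \<bullet> mu F t"

definition curv_n :: "real set \<Rightarrow> frame_map \<Rightarrow> real \<Rightarrow> real" where
  "curv_n I F t = deriv_on I (nu2 F) t \<bullet> mu F t"

definition curv_a :: "real set \<Rightarrow> frame_map \<Rightarrow> real \<Rightarrow> real" where
  "curv_a I F t = deriv_on I (gam F) t \<bullet> mu F t"

definition evolute_condition ::
  "real set \<Rightarrow> frame_map \<Rightarrow> (real \<Rightarrow> real) \<Rightarrow> (real \<Rightarrow> real) \<Rightarrow> (real \<Rightarrow> real) \<Rightarrow> bool" where
  "evolute_condition I F lam eta theta \<longleftrightarrow>
     (\<forall>t\<in>I. curv_a I F t + lam t * curv_m I F t + eta t * curv_n I F t = 0 \<and>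
        (deriv_on I lam t - eta t * curv_l I F t) * sin (theta t)
          + (lam t * curv_l I F t + deriv_on I eta t) * cos (theta t) = 0)"

definition evolute_exists ::
  "real set \<Rightarrow> frame_map \<Rightarrow> (real \<Rightarrow> real) \<Rightarrow> (real \<Rightarrow> real) \<Rightarrow> (real \<Rightarrow> real) \<Rightarrow> bool" where
  "evolute_exists I F lam eta theta \<longleftrightarrow>
     framed_curve I F \<and> smooth_on I (\<lambda>t. (lam t, eta t)) \<and> smooth_on I theta \<and>
     evolute_condition I F lam eta theta"

definition evolute ::
  "frame_map \<Rightarrow> (real \<Rightarrow> real) \<Rightarrow> (real \<Rightarrow> real) \<Rightarrow> (real \<Rightarrow> real) \<Rightarrow> frame_map" where
  "evolute F lam eta theta t =
     (gam F t + lam t *\<^sub>R nu1 F t + eta t *\<^sub>R nu2 F t,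
      sin (theta t) *\<^sub>R nu1 F t + cos (theta t) *\<^sub>R nu2 F t,
      mu F t)"

definition involute_condition ::
  "real set \<Rightarrow> frame_map \<Rightarrow> (real \<Rightarrow> real) \<Rightarrow> (real \<Rightarrow> real) \<Rightarrow> bool" where
  "involute_condition I F lam eta \<longleftrightarrow>
     (\<forall>t\<in>I. - lam t * curv_m I F t + deriv_on I eta t = 0 \<and>
        curv_a I F t + deriv_on I lam t + eta t * curv_m I F t = 0)"

(* The angle theta of an involute is an arbitrary smooth function, so existence of the
   involute depends on lam and eta only. *)
definition involute_exists ::
  "real set \<Rightarrow> frame_map \<Rightarrow> (real \<Rightarrow> real) \<Rightarrow> (real \<Rightarrow> real) \<Rightarrow> bool" where
  "involute_exists I F lam eta \<longleftrightarrow>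
     framed_curve I F \<and> smooth_on I (\<lambda>t. (lam t, eta t)) \<and> involute_condition I F lam eta"

definition involute ::
  "frame_map \<Rightarrow> (real \<Rightarrow> real) \<Rightarrow> (real \<Rightarrow> real) \<Rightarrow> (real \<Rightarrow> real) \<Rightarrow> frame_map" where
  "involute F lam eta theta t =
     (gam F t + lam t *\<^sub>R mu F t + eta t *\<^sub>R nu1 F t,
      cos (theta t) *\<^sub>R mu F t - sin (theta t) *\<^sub>R nu1 F t,
      sin (theta t) *\<^sub>R mu F t + cos (theta t) *\<^sub>R nu1 F t)"

end

theory Submission
  imports Defs
begin

text \<open>
  The two conditions of the theorem are framed-curve conditions in disguise.  Let
  \<open>E = gam + lam nu1 + eta nu2\<close> be the candidate evolute.  Differentiating it in the moving
  frame shows that the two equations of the evolute condition say that \<open>E'\<close> is orthogonal to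
  \<open>mu\<close> and to \<open>sin theta nu1 + cos theta nu2\<close>, which are exactly the two frame vectors of the
  evolute; so the condition holds iff the evolute, with its frame, is a framed curve
  (\<open>framed_curve_evolute_iff\<close>).  Likewise the involute condition says that the derivative of
  \<open>gam + lam mu + eta nu1\<close> is orthogonal to the plane spanned by \<open>mu\<close> and \<open>nu1\<close>, which is
  the plane of the frame of the involute whatever its angle is
  (\<open>framed_curve_involute_iff\<close>).

  With the prescribed functions, linear algebra in an orthonormal frame shows that the two
  constructions undo each other pointwise (\<open>evolute_involute\<close>, \<open>involute_evolute\<close>): the
  coefficients are those of the displacement back to the original point, expressed in the
  new, rotated frame.  Hence the evolute of the involute is the given framed curve, and being
  a framed curve it certifies the evolute condition; no curvature of the intermediate curve
  has to be computed.  The second part is symmetric.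

  The remaining work is to show that smoothness relative to an interval is inherited by
  everything built from smooth maps by sums, bilinear products, sine and cosine.
\<close>

section \<open>Smooth maps on a set without isolated points\<close>

text \<open>
  The iterates of \<^const>\<open>deriv_on\<close> are awkward in calculus rules, since such rules produce a
  derivative that agrees with \<^const>\<open>deriv_on\<close> only on the set.  The following notion of being
  \<open>k\<close> times differentiable accepts any such derivative.
\<close>

fun diff_times :: "nat \<Rightarrow> real set \<Rightarrow> (real \<Rightarrow> 'a::real_normed_vector) \<Rightarrow> bool" where
  "diff_times 0 I f = True"
| "diff_times (Suc k) I f =
     (\<exists>f'. (\<forall>t\<in>I. (f has_vector_derivative f' t) (at t within I)) \<and> diff_times k I f')"

lemma diff_times_SucI:
  assumes "\<And>t. t \<in> I \<Longrightarrow> (f has_vector_derivative f' t) (at t within I)" and "diff_times k I f'"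
  shows "diff_times (Suc k) I f"
  using assms by auto

lemma diff_times_SucD: "diff_times (Suc k) I f \<Longrightarrow> diff_times k I f"
proof (induction k arbitrary: f)
  case (Suc k)
  from Suc.prems obtain f' where
    f': "\<forall>t\<in>I. (f has_vector_derivative f' t) (at t within I)" "diff_times (Suc k) I f'"
    unfolding diff_times.simps(2)[of "Suc k"] by blast
  from f'(1) Suc.IH[OF f'(2)] show ?case by (intro diff_times_SucI[of I f f']) simp_all
qed simp

lemma diff_times_cong:
  assumes "diff_times k I f" and "\<And>t. t \<in> I \<Longrightarrow> f t = g t"
  shows "diff_times k I g"
proof (cases k)
  case 0
  then show ?thesis by simp
next
  case (Suc j)
  with assms(1) obtain f' where
    f': "\<And>t. t \<in> I \<Longrightarrow> (f has_vector_derivative f' t) (at t within I)" "diff_times j I f'"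
    by auto
  have "(g has_vector_derivative f' t) (at t within I)" if "t \<in> I" for t
    by (rule has_vector_derivative_transform[OF that _ f'(1)[OF that]]) (simp add: assms(2))
  with f'(2) Suc show ?thesis by (simp only:) (rule diff_times_SucI[of I g f'])
qed

lemma has_vector_derivative_deriv_on:
  assumes "f differentiable (at t within I)"
  shows "(f has_vector_derivative deriv_on I f t) (at t within I)"
  using assms by (simp add: deriv_on_def vector_derivative_works)

lemma deriv_on_eqI:
  assumes "(f has_vector_derivative f') (at t within I)" and "at t within I \<noteq> bot"
  shows "deriv_on I f t = f'"
  unfolding deriv_on_def using assms vector_derivative_within by blast

text \<open>
  Without isolated points derivatives relative to the set are unique, so the derivatives
  chosen in \<^const>\<open>diff_times\<close> are forced to be those of \<^const>\<open>deriv_on\<close>.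
\<close>

lemma smooth_on_iff_diff_times:
  assumes perfect: "\<forall>t\<in>I. at t within I \<noteq> bot"
  shows "smooth_on I f \<longleftrightarrow> (\<forall>k. diff_times k I f)"
proof
  assume f: "smooth_on I f"
  have "diff_times k I ((deriv_on I ^^ j) f)" for k j
  proof (induction k arbitrary: j)
    case (Suc k)
    have "((deriv_on I ^^ j) f has_vector_derivative (deriv_on I ^^ Suc j) f t) (at t within I)"
      if "t \<in> I" for t
      using f that by (simp add: smooth_on_def has_vector_derivative_deriv_on)
    then show ?case using Suc.IH[of "Suc j"] by (rule diff_times_SucI)
  qed simp
  from this[of _ 0] show "\<forall>k. diff_times k I f" by simp
next
  have "\<forall>t\<in>I. (deriv_on I ^^ k) g differentiable (at t within I)"
    if "diff_times (Suc k) I g" for k and g :: "real \<Rightarrow> 'a"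
    using that
  proof (induction k arbitrary: g)
    case 0
    then show ?case by (auto intro: differentiableI_vector)
  next
    case (Suc k)
    from Suc.prems obtain g' where
      g': "\<And>t. t \<in> I \<Longrightarrow> (g has_vector_derivative g' t) (at t within I)" "diff_times (Suc k) I g'"
      unfolding diff_times.simps(2)[of "Suc k"] by blast
    have "diff_times (Suc k) I (deriv_on I g)"
      using g' perfect by (intro diff_times_cong[OF g'(2)]) (metis deriv_on_eqI)
    from Suc.IH[OF this] show ?case by (simp add: funpow_swap1)
  qed
  moreover assume "\<forall>k. diff_times k I f"
  ultimately show "smooth_on I f" unfolding smooth_on_def by blast
qed

lemma diff_times_bounded_linear:
  assumes "bounded_linear h" and "diff_times k I f"
  shows "diff_times k I (\<lambda>t. h (f t))"
  using assms(2)
proof (induction k arbitrary: f)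
  case (Suc k)
  from Suc.prems obtain f' where
    "\<And>t. t \<in> I \<Longrightarrow> (f has_vector_derivative f' t) (at t within I)" "diff_times k I f'"
    by auto
  then show ?case
    by (intro diff_times_SucI[of _ _ "\<lambda>t. h (f' t)"] Suc.IH
        bounded_linear.has_vector_derivative[OF assms(1)])
qed simp

lemma diff_times_add:
  "diff_times k I f \<Longrightarrow> diff_times k I g \<Longrightarrow> diff_times k I (\<lambda>t. f t + g t)"
proof (induction k arbitrary: f g)
  case (Suc k)
  from Suc.prems(1) obtain f' where
    f': "\<And>t. t \<in> I \<Longrightarrow> (f has_vector_derivative f' t) (at t within I)" "diff_times k I f'"
    by auto
  from Suc.prems(2) obtain g' where
    g': "\<And>t. t \<in> I \<Longrightarrow> (g has_vector_derivative g' t) (at t within I)" "diff_times k I g'"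
    by auto
  show ?case
    by (intro diff_times_SucI[of _ _ "\<lambda>t. f' t + g' t"] Suc.IH f' g' has_vector_derivative_add)
qed simp

lemma diff_times_bounded_bilinear:
  assumes h: "bounded_bilinear h"
  shows "diff_times k I f \<Longrightarrow> diff_times k I g \<Longrightarrow> diff_times k I (\<lambda>t. h (f t) (g t))"
proof (induction k arbitrary: f g)
  case (Suc k)
  from Suc.prems(1) obtain f' where
    f': "\<And>t. t \<in> I \<Longrightarrow> (f has_vector_derivative f' t) (at t within I)" "diff_times k I f'"
    by auto
  from Suc.prems(2) obtain g' where
    g': "\<And>t. t \<in> I \<Longrightarrow> (g has_vector_derivative g' t) (at t within I)" "diff_times k I g'"
    by auto
  have "diff_times k I (\<lambda>t. h (f t) (g' t) + h (f' t) (g t))"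
    using diff_times_add[OF Suc.IH[OF diff_times_SucD[OF Suc.prems(1)] g'(2)]
        Suc.IH[OF f'(2) diff_times_SucD[OF Suc.prems(2)]]] .
  then show ?case
  proof (rule diff_times_SucI[rotated])
    show "((\<lambda>t. h (f t) (g t)) has_vector_derivative h (f t) (g' t) + h (f' t) (g t))
    (at t within I)" if "t \<in> I" for t
      using f'(1)[OF that] g'(1)[OF that] by (rule bounded_bilinear.has_vector_derivative[OF h])
  qed
qed simp

text \<open>Sine and cosine go through the induction together, each being the derivative of the
  other up to sign.\<close>

lemma diff_times_sin_cos:
  "diff_times k I f \<Longrightarrow> diff_times k I (\<lambda>t. sin (f t :: real)) \<and> diff_times k I (\<lambda>t. cos (f t))"
proof (induction k arbitrary: f)
  case (Suc k)
  from Suc.prems obtain f' where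
    f': "\<And>t. t \<in> I \<Longrightarrow> (f has_vector_derivative f' t) (at t within I)" "diff_times k I f'"
    by auto
  have sc: "diff_times k I (\<lambda>t. sin (f t))" "diff_times k I (\<lambda>t. cos (f t))"
    using Suc.IH[OF diff_times_SucD[OF Suc.prems]] by auto
  have "diff_times k I (\<lambda>t. f' t * cos (f t))" "diff_times k I (\<lambda>t. - (f' t * sin (f t)))"
    using f'(2) sc
    by (auto intro!: diff_times_bounded_bilinear[OF bounded_bilinear_mult]
        diff_times_bounded_linear[OF bounded_linear_minus[OF bounded_linear_ident]])
  moreover have
    "((\<lambda>t. sin (f t)) has_vector_derivative f' t * cos (f t)) (at t within I)"
    "((\<lambda>t. cos (f t)) has_vector_derivative - (f' t * sin (f t))) (at t within I)"
    if "t \<in> I" for t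
    using f'(1)[OF that] unfolding has_real_derivative_iff_has_vector_derivative[symmetric]
    by (auto intro!: derivative_eq_intros)
  ultimately show ?case
    using diff_times_SucI[of I "\<lambda>t. sin (f t)" "\<lambda>t. f' t * cos (f t)" k]
      diff_times_SucI[of I "\<lambda>t. cos (f t)" "\<lambda>t. - (f' t * sin (f t))" k]
    by metis
qed simp

lemma smooth_on_bounded_linear:
  assumes "\<forall>t\<in>I. at t within I \<noteq> bot" and "bounded_linear h" and "smooth_on I f"
  shows "smooth_on I (\<lambda>t. h (f t))"
  using assms(3) diff_times_bounded_linear[OF assms(2), of _ I f]
  by (simp add: smooth_on_iff_diff_times[OF assms(1)])

lemma smooth_on_bounded_bilinear:
  assumes "\<forall>t\<in>I. at t within I \<noteq> bot" and "bounded_bilinear h"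
    and "smooth_on I f" and "smooth_on I g"
  shows "smooth_on I (\<lambda>t. h (f t) (g t))"
  using assms(3,4) diff_times_bounded_bilinear[OF assms(2), of _ I f g]
  by (simp add: smooth_on_iff_diff_times[OF assms(1)])

lemma smooth_on_add:
  assumes "\<forall>t\<in>I. at t within I \<noteq> bot" and "smooth_on I f" and "smooth_on I g"
  shows "smooth_on I (\<lambda>t. f t + g t)"
  using assms(2,3) diff_times_add[of _ I f g]
  by (simp add: smooth_on_iff_diff_times[OF assms(1)])

lemma smooth_on_minus:
  assumes "\<forall>t\<in>I. at t within I \<noteq> bot" and "smooth_on I f"
  shows "smooth_on I (\<lambda>t. - f t)"
  using smooth_on_bounded_linear[OF assms(1) bounded_linear_minus[OF bounded_linear_ident] assms(2)] .

lemma smooth_on_diff: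
  assumes "\<forall>t\<in>I. at t within I \<noteq> bot" and "smooth_on I f" and "smooth_on I g"
  shows "smooth_on I (\<lambda>t. f t - g t)"
  using smooth_on_add[OF assms(1,2) smooth_on_minus[OF assms(1,3)]] by simp

lemma smooth_on_sin_cos:
  assumes "\<forall>t\<in>I. at t within I \<noteq> bot" and "smooth_on I f"
  shows "smooth_on I (\<lambda>t. sin (f t :: real))" and "smooth_on I (\<lambda>t. cos (f t))"
  using assms(2) diff_times_sin_cos[of _ I f] by (simp_all add: smooth_on_iff_diff_times[OF assms(1)])

lemma bounded_bilinear_cross3: "bounded_bilinear cross3"
  by (rule iffD1[OF bilinear_conv_bounded_bilinear bilinear_cross])

lemma smooth_on_Pair_iff:
  assumes perfect: "\<forall>t\<in>I. at t within I \<noteq> bot"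
  shows "smooth_on I (\<lambda>t. (f t, g t)) \<longleftrightarrow> smooth_on I f \<and> smooth_on I g"
proof (intro iffI conjI)
  assume "smooth_on I (\<lambda>t. (f t, g t))"
  from smooth_on_bounded_linear[OF perfect bounded_linear_fst this]
    smooth_on_bounded_linear[OF perfect bounded_linear_snd this]
  show "smooth_on I f" "smooth_on I g" by simp_all
next
  assume "smooth_on I f \<and> smooth_on I g"
  then have "smooth_on I (\<lambda>t. (f t, 0))" "smooth_on I (\<lambda>t. (0, g t))"
    using smooth_on_bounded_linear[OF perfect, of "\<lambda>x. (x, 0)" f]
      smooth_on_bounded_linear[OF perfect, of "\<lambda>y. (0, y)" g]
    by (simp_all add: bounded_linear_Pair bounded_linear_ident bounded_linear_zero)
  from smooth_on_add[OF perfect this] show "smooth_on I (\<lambda>t. (f t, g t))" by simp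
qed

lemmas smooth_on_intros =
  smooth_on_add smooth_on_diff smooth_on_minus smooth_on_sin_cos
  smooth_on_bounded_bilinear[OF _ bounded_bilinear_mult]
  smooth_on_bounded_bilinear[OF _ bounded_bilinear_scaleR]
  smooth_on_bounded_bilinear[OF _ bounded_bilinear_cross3]

lemma smooth_on_has_vector_derivative:
  assumes "smooth_on I f" and "t \<in> I"
  shows "(f has_vector_derivative deriv_on I f t) (at t within I)"
proof -
  have "(deriv_on I ^^ 0) f differentiable (at t within I)"
    using assms unfolding smooth_on_def by blast
  then show ?thesis by (simp add: has_vector_derivative_deriv_on)
qed

lemma smooth_on_cong:
  assumes "\<forall>t\<in>I. at t within I \<noteq> bot" and "smooth_on I f" and "\<And>t. t \<in> I \<Longrightarrow> f t = g t"
  shows "smooth_on I g"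
  using assms by (metis smooth_on_iff_diff_times diff_times_cong)

lemma at_within_interval_neq_bot:
  fixes I :: "real set"
  assumes "is_interval I" and "interior I \<noteq> {}" and "t \<in> I"
  shows "at t within I \<noteq> bot"
proof -
  have "I \<noteq> {t}" using assms(2) by auto
  then have "t islimpt I"
    using assms by (intro connected_imp_perfect) (auto simp: is_interval_connected)
  then show ?thesis by (simp add: trivial_limit_within)
qed

section \<open>The moving frame\<close>

lemma frame_cross3:
  assumes "(a, b) \<in> Delta"
  shows "a \<bullet> a = 1" "b \<bullet> b = 1" "a \<bullet> b = 0" "b \<bullet> a = 0"
    "a \<bullet> cross3 a b = 0" "b \<bullet> cross3 a b = 0" "cross3 a b \<bullet> a = 0" "cross3 a b \<bullet> b = 0"
    "cross3 a b \<bullet> cross3 a b = 1"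
    "cross3 a (cross3 a b) = - b" "cross3 b (cross3 a b) = a"
    "cross3 (cross3 a b) a = b"
proof -
  show n: "a \<bullet> a = 1" "b \<bullet> b = 1" and o: "a \<bullet> b = 0"
    using assms by (auto simp: Delta_def dot_square_norm)
  show o': "b \<bullet> a = 0" using o by (simp add: inner_commute)
  show "a \<bullet> cross3 a b = 0" "b \<bullet> cross3 a b = 0" "cross3 a b \<bullet> a = 0" "cross3 a b \<bullet> b = 0"
    by (simp_all add: dot_cross_self)
  show "cross3 a b \<bullet> cross3 a b = 1" by (simp add: dot_cross n o o')
  show ab: "cross3 a (cross3 a b) = - b" "cross3 b (cross3 a b) = a"
    by (simp_all add: Lagrange n o o')
  show "cross3 (cross3 a b) a = b"
    using ab(1) cross_skew[of "cross3 a b" a] by simp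
qed

lemma framed_curve_Delta:
  assumes "framed_curve I F" and "t \<in> I"
  shows "(nu1 F t, nu2 F t) \<in> Delta"
  using assms by (fastforce simp: framed_curve_def nu1_def nu2_def)

lemma frame_map_eq: "F t = (gam F t, nu1 F t, nu2 F t)"
  by (simp add: gam_def nu1_def nu2_def)

lemma framed_curve_iff:
  assumes "\<forall>t\<in>I. at t within I \<noteq> bot"
  shows "framed_curve I F \<longleftrightarrow>
    smooth_on I (gam F) \<and> smooth_on I (nu1 F) \<and> smooth_on I (nu2 F) \<and>
    (\<forall>t\<in>I. (nu1 F t, nu2 F t) \<in> Delta \<and>
      deriv_on I (gam F) t \<bullet> nu1 F t = 0 \<and> deriv_on I (gam F) t \<bullet> nu2 F t = 0)"
proof -
  have "smooth_on I F \<longleftrightarrow> smooth_on I (\<lambda>t. (gam F t, nu1 F t, nu2 F t))"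
    by (simp flip: frame_map_eq)
  also have "\<dots> \<longleftrightarrow> smooth_on I (gam F) \<and> smooth_on I (nu1 F) \<and> smooth_on I (nu2 F)"
    using assms by (simp add: smooth_on_Pair_iff)
  finally have "smooth_on I F \<longleftrightarrow> \<dots>" .
  moreover have "F t \<in> UNIV \<times> Delta \<longleftrightarrow> (nu1 F t, nu2 F t) \<in> Delta" for t
    by (subst frame_map_eq) simp
  ultimately show ?thesis unfolding framed_curve_def by blast
qed

lemma smooth_on_mu:
  assumes "\<forall>t\<in>I. at t within I \<noteq> bot" and "framed_curve I F"
  shows "smooth_on I (mu F)"
proof -
  have "smooth_on I (\<lambda>t. cross3 (nu1 F t) (nu2 F t))"
    using assms framed_curve_iff by (intro smooth_on_intros) blast+
  then show ?thesis by (simp add: mu_def[abs_def])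
qed

lemma framed_curve_cong:
  assumes perfect: "\<forall>t\<in>I. at t within I \<noteq> bot"
    and F: "framed_curve I F" and eq: "\<And>t. t \<in> I \<Longrightarrow> G t = F t"
  shows "framed_curve I G"
proof -
  have sm: "smooth_on I G" using F eq by (auto simp: framed_curve_def intro: smooth_on_cong[OF perfect])
  have "deriv_on I (gam G) t = deriv_on I (gam F) t" if t: "t \<in> I" for t
  proof (rule deriv_on_eqI)
    have "(gam F has_vector_derivative deriv_on I (gam F) t) (at t within I)"
      using F t perfect framed_curve_iff smooth_on_has_vector_derivative by blast
    then show "(gam G has_vector_derivative deriv_on I (gam F) t) (at t within I)"
      by (rule has_vector_derivative_transform[OF t, rotated]) (simp add: gam_def eq)
  qed (use perfect t in blast)
  with F eq sm show ?thesis by (simp add: framed_curve_def nu1_def nu2_def)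
qed

text \<open>Differentiating the constant pairwise inner products of the frame vectors gives the
  skew-symmetry of the matrix of curvatures.\<close>

lemma inner_derivative_skew:
  assumes "(f has_vector_derivative f') (at t within I)"
    and "(g has_vector_derivative g') (at t within I)"
    and const: "\<And>s. s \<in> I \<Longrightarrow> f s \<bullet> g s = c" and t: "t \<in> I" and "at t within I \<noteq> bot"
  shows "f t \<bullet> g' = - (f' \<bullet> g t)"
proof -
  have "((\<lambda>s. f s \<bullet> g s) has_vector_derivative f t \<bullet> g' + f' \<bullet> g t) (at t within I)"
    by (rule bounded_bilinear.has_vector_derivative[OF bounded_bilinear_inner assms(1,2)])
  moreover have "((\<lambda>s. f s \<bullet> g s) has_vector_derivative 0) (at t within I)"
    by (rule has_vector_derivative_transform[OF t const has_vector_derivative_const])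
  ultimately have "f t \<bullet> g' + f' \<bullet> g t = 0"
    using deriv_on_eqI[OF _ assms(5)] by metis
  then show ?thesis by simp
qed

section \<open>The conditions characterise framed curves\<close>

text \<open>
  The two equations of the evolute condition are the inner products of the derivative of the
  evolute with its two frame vectors, in reverse order.
\<close>

lemma framed_curve_evolute_iff:
  assumes perfect: "\<forall>t\<in>I. at t within I \<noteq> bot" and F: "framed_curve I F"
    and sm: "smooth_on I lam" "smooth_on I eta" "smooth_on I theta"
  shows "framed_curve I (evolute F lam eta theta) \<longleftrightarrow> evolute_condition I F lam eta theta"
proof -
  let ?G = "evolute F lam eta theta"
  have comps: "gam ?G = (\<lambda>t. gam F t + lam t *\<^sub>R nu1 F t + eta t *\<^sub>R nu2 F t)"
    "nu1 ?G = (\<lambda>t. sin (theta t) *\<^sub>R nu1 F t + cos (theta t) *\<^sub>R nu2 F t)" "nu2 ?G = mu F"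
    by (auto simp: gam_def nu1_def nu2_def evolute_def fun_eq_iff)
  have smF: "smooth_on I (gam F)" "smooth_on I (nu1 F)" "smooth_on I (nu2 F)"
    and tangent: "\<And>t. t \<in> I \<Longrightarrow> deriv_on I (gam F) t \<bullet> nu1 F t = 0 \<and> deriv_on I (gam F) t \<bullet> nu2 F t = 0"
    using F framed_curve_iff[OF perfect] by blast+
  have "smooth_on I (gam ?G)" "smooth_on I (nu1 ?G)" "smooth_on I (nu2 ?G)"
    unfolding comps using smF sm perfect F by (auto intro!: smooth_on_intros smooth_on_mu)
  moreover have "(nu1 ?G t, nu2 ?G t) \<in> Delta" if "t \<in> I" for t
  proof -
    note fr = frame_cross3[OF framed_curve_Delta[OF F that]]
    have "sin (theta t) * sin (theta t) + cos (theta t) * cos (theta t) = 1"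
      by (metis power2_eq_square sin_cos_squared_add)
    then show ?thesis
      by (simp add: comps Delta_def norm_eq_1 mu_def inner_add_left inner_add_right fr)
  qed
  moreover have
    "deriv_on I (gam ?G) t \<bullet> nu2 ?G t = curv_a I F t + lam t * curv_m I F t + eta t * curv_n I F t"
    "deriv_on I (gam ?G) t \<bullet> nu1 ?G t = (deriv_on I lam t - eta t * curv_l I F t) * sin (theta t)
      + (lam t * curv_l I F t + deriv_on I eta t) * cos (theta t)" if t: "t \<in> I" for t
  proof -
    note fr = frame_cross3[OF framed_curve_Delta[OF F]]
    note D = smooth_on_has_vector_derivative[OF _ t]
    have nb: "at t within I \<noteq> bot" using perfect t by blast
    have E': "deriv_on I (gam ?G) t = deriv_on I (gam F) t
      + (lam t *\<^sub>R deriv_on I (nu1 F) t + deriv_on I lam t *\<^sub>R nu1 F t)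
      + (eta t *\<^sub>R deriv_on I (nu2 F) t + deriv_on I eta t *\<^sub>R nu2 F t)"
      unfolding comps
      by (intro deriv_on_eqI[OF _ nb] has_vector_derivative_add D
          bounded_bilinear.has_vector_derivative[OF bounded_bilinear_scaleR] smF sm)
    have skew: "deriv_on I (nu1 F) t \<bullet> nu1 F t = 0" "deriv_on I (nu2 F) t \<bullet> nu2 F t = 0"
      "deriv_on I (nu2 F) t \<bullet> nu1 F t = - curv_l I F t"
      using inner_derivative_skew[OF D[OF smF(2)] D[OF smF(2)] fr(1) t nb]
        inner_derivative_skew[OF D[OF smF(3)] D[OF smF(3)] fr(2) t nb]
        inner_derivative_skew[OF D[OF smF(2)] D[OF smF(3)] fr(3) t nb]
      by (simp_all add: inner_commute curv_l_def)
    show "deriv_on I (gam ?G) t \<bullet> nu2 ?G t = curv_a I F t + lam t * curv_m I F t + eta t * curv_n I F t"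
      unfolding E' unfolding comps(2,3)
      by (simp add: inner_add_left curv_a_def curv_m_def curv_n_def mu_def fr t)
    show "deriv_on I (gam ?G) t \<bullet> nu1 ?G t = (deriv_on I lam t - eta t * curv_l I F t) * sin (theta t)
      + (lam t * curv_l I F t + deriv_on I eta t) * cos (theta t)"
      unfolding E' unfolding comps(2,3)
      by (simp add: inner_add_left inner_add_right tangent[OF t] skew fr t
          flip: curv_l_def)
  qed
  ultimately show ?thesis
    unfolding framed_curve_iff[OF perfect] evolute_condition_def by auto
qed

text \<open>
  Here the frame of the involute is \<open>(mu, nu1)\<close> rotated by \<open>theta\<close>, so orthogonality to it
  does not depend on the angle.
\<close>

lemma framed_curve_involute_iff:
  assumes perfect: "\<forall>t\<in>I. at t within I \<noteq> bot" and F: "framed_curve I F"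
    and sm: "smooth_on I lam" "smooth_on I eta" "smooth_on I theta"
  shows "framed_curve I (involute F lam eta theta) \<longleftrightarrow> involute_condition I F lam eta"
proof -
  let ?G = "involute F lam eta theta"
  have comps: "gam ?G = (\<lambda>t. gam F t + lam t *\<^sub>R mu F t + eta t *\<^sub>R nu1 F t)"
    "nu1 ?G = (\<lambda>t. cos (theta t) *\<^sub>R mu F t - sin (theta t) *\<^sub>R nu1 F t)"
    "nu2 ?G = (\<lambda>t. sin (theta t) *\<^sub>R mu F t + cos (theta t) *\<^sub>R nu1 F t)"
    by (auto simp: gam_def nu1_def nu2_def mu_def involute_def fun_eq_iff)
  have smF: "smooth_on I (gam F)" "smooth_on I (nu1 F)" "smooth_on I (mu F)"
    and tangent: "\<And>t. t \<in> I \<Longrightarrow> deriv_on I (gam F) t \<bullet> nu1 F t = 0"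
    using F framed_curve_iff[OF perfect] smooth_on_mu[OF perfect] by blast+
  have sc: "sin (theta t) * sin (theta t) + cos (theta t) * cos (theta t) = 1" for t
    by (metis power2_eq_square sin_cos_squared_add)
  have "smooth_on I (gam ?G)" "smooth_on I (nu1 ?G)" "smooth_on I (nu2 ?G)"
    unfolding comps using smF sm perfect by (auto intro!: smooth_on_intros)
  moreover have "(nu1 ?G t, nu2 ?G t) \<in> Delta" if "t \<in> I" for t
    using sc[of t] frame_cross3[OF framed_curve_Delta[OF F that]]
    by (simp add: comps Delta_def norm_eq_1 mu_def algebra_simps)
  moreover have "deriv_on I (gam ?G) t \<bullet> nu1 ?G t = 0 \<and> deriv_on I (gam ?G) t \<bullet> nu2 ?G t = 0 \<longleftrightarrow>
      - lam t * curv_m I F t + deriv_on I eta t = 0 \<and>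
      curv_a I F t + deriv_on I lam t + eta t * curv_m I F t = 0" if t: "t \<in> I" for t
  proof -
    note fr = frame_cross3[OF framed_curve_Delta[OF F], folded mu_def]
    note D = smooth_on_has_vector_derivative[OF _ t]
    have nb: "at t within I \<noteq> bot" using perfect t by blast
    have J': "deriv_on I (gam ?G) t = deriv_on I (gam F) t
      + (lam t *\<^sub>R deriv_on I (mu F) t + deriv_on I lam t *\<^sub>R mu F t)
      + (eta t *\<^sub>R deriv_on I (nu1 F) t + deriv_on I eta t *\<^sub>R nu1 F t)"
      unfolding comps
      by (intro deriv_on_eqI[OF _ nb] has_vector_derivative_add D
          bounded_bilinear.has_vector_derivative[OF bounded_bilinear_scaleR] smF sm)
    have skew: "deriv_on I (nu1 F) t \<bullet> nu1 F t = 0" "deriv_on I (mu F) t \<bullet> mu F t = 0"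
      "deriv_on I (mu F) t \<bullet> nu1 F t = - curv_m I F t"
      using inner_derivative_skew[OF D[OF smF(2)] D[OF smF(2)] fr(1) t nb]
        inner_derivative_skew[OF D[OF smF(3)] D[OF smF(3)] fr(9) t nb]
        inner_derivative_skew[OF D[OF smF(2)] D[OF smF(3)] fr(5) t nb]
      by (simp_all add: inner_commute curv_m_def)
    define x where "x = deriv_on I (gam ?G) t \<bullet> mu F t"
    define y where "y = deriv_on I (gam ?G) t \<bullet> nu1 F t"
    have x: "x = curv_a I F t + deriv_on I lam t + eta t * curv_m I F t"
      unfolding x_def J' by (simp add: inner_add_left curv_a_def curv_m_def skew fr t)
    have y: "y = - lam t * curv_m I F t + deriv_on I eta t"
      unfolding y_def J' by (simp add: inner_add_left tangent[OF t] skew fr t)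
    let ?s = "sin (theta t)" and ?c = "cos (theta t)"
    have "deriv_on I (gam ?G) t \<bullet> nu1 ?G t = ?c * x - ?s * y"
      "deriv_on I (gam ?G) t \<bullet> nu2 ?G t = ?s * x + ?c * y"
      unfolding comps x_def y_def by (simp_all add: inner_add_right inner_diff_right)
    \<comment> \<open>the inverse rotation recovers both components, so they vanish together\<close>
    moreover have "x = ?c * (?c * x - ?s * y) + ?s * (?s * x + ?c * y)"
      "y = ?c * (?s * x + ?c * y) - ?s * (?c * x - ?s * y)"
      using sc[of t] by algebra+
    ultimately have "deriv_on I (gam ?G) t \<bullet> nu1 ?G t = 0 \<and> deriv_on I (gam ?G) t \<bullet> nu2 ?G t = 0
        \<longleftrightarrow> y = 0 \<and> x = 0"
      by auto
    then show ?thesis unfolding x y .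
  qed
  ultimately show ?thesis
    unfolding framed_curve_iff[OF perfect] involute_condition_def by auto
qed

section \<open>The constructions are mutually inverse\<close>

text \<open>
  The involute has \<open>mu F \<times> nu1 F = nu2 F\<close> as its unit tangent, which the evolute takes for its
  second frame vector; the rest is the rotation by \<open>theta\<close> followed by its inverse.
\<close>

lemma evolute_involute:
  assumes "(nu1 F t, nu2 F t) \<in> Delta"
  shows "evolute (involute F lam eta theta)
    (\<lambda>t. - lam t * cos (theta t) + eta t * sin (theta t))
    (\<lambda>t. - lam t * sin (theta t) - eta t * cos (theta t)) (\<lambda>t. - theta t) t = F t"
proof -
  let ?G = "involute F lam eta theta" and ?s = "sin (theta t)" and ?c = "cos (theta t)"
  note fr = frame_cross3[OF assms, folded mu_def]
  have sc: "?s * ?s + ?c * ?c = 1"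
    by (metis power2_eq_square sin_cos_squared_add)
  have comps: "gam ?G t = gam F t + lam t *\<^sub>R mu F t + eta t *\<^sub>R nu1 F t"
    "nu1 ?G t = ?c *\<^sub>R mu F t - ?s *\<^sub>R nu1 F t" "nu2 ?G t = ?s *\<^sub>R mu F t + ?c *\<^sub>R nu1 F t"
    by (auto simp: gam_def nu1_def nu2_def mu_def involute_def)
  have "mu ?G t = (?s * ?s) *\<^sub>R nu2 F t + (?c * ?c) *\<^sub>R nu2 F t"
    unfolding mu_def[of ?G] comps
    by (simp add: cross_add_right Cross3.left_diff_distrib cross_mult_left cross_mult_right fr)
  then have mu: "mu ?G t = nu2 F t" by (simp add: sc flip: scaleR_left_distrib)
  have gam: "(- lam t * ?c + eta t * ?s) * ?c + (- lam t * ?s - eta t * ?c) * ?s = - lam t"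
    "- (- lam t * ?c + eta t * ?s) * ?s + (- lam t * ?s - eta t * ?c) * ?c = - eta t"
    using sc by algebra+
  have "gam ?G t + (- lam t * ?c + eta t * ?s) *\<^sub>R nu1 ?G t + (- lam t * ?s - eta t * ?c) *\<^sub>R nu2 ?G t
    = gam F t + lam t *\<^sub>R mu F t + eta t *\<^sub>R nu1 F t
      + ((- lam t * ?c + eta t * ?s) * ?c + (- lam t * ?s - eta t * ?c) * ?s) *\<^sub>R mu F t
      + (- (- lam t * ?c + eta t * ?s) * ?s + (- lam t * ?s - eta t * ?c) * ?c) *\<^sub>R nu1 F t"
    unfolding comps by (simp add: algebra_simps)
  also have "\<dots> = gam F t" unfolding gam by simp
  finally have 1: "gam ?G t + (- lam t * ?c + eta t * ?s) *\<^sub>R nu1 ?G t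
    + (- lam t * ?s - eta t * ?c) *\<^sub>R nu2 ?G t = gam F t" .
  have "sin (- theta t) *\<^sub>R nu1 ?G t + cos (- theta t) *\<^sub>R nu2 ?G t = (?s * ?s) *\<^sub>R nu1 F t + (?c * ?c) *\<^sub>R nu1 F t"
    unfolding comps by (simp add: algebra_simps)
  with 1 mu sc show ?thesis
    unfolding evolute_def by (subst frame_map_eq[of F]) (simp flip: scaleR_left_distrib)
qed

text \<open>
  The unit tangent of the evolute is \<open>cos theta nu1 - sin theta nu2\<close>, so its tangent and first
  frame vector span the plane of \<open>nu1\<close> and \<open>nu2\<close>, which is the plane used by the involute.
\<close>

lemma involute_evolute:
  assumes "(nu1 F t, nu2 F t) \<in> Delta"
  shows "involute (evolute F lam eta theta)
    (\<lambda>t. - lam t * cos (theta t) + eta t * sin (theta t))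
    (\<lambda>t. - lam t * sin (theta t) - eta t * cos (theta t)) (\<lambda>t. - theta t) t = F t"
proof -
  let ?G = "evolute F lam eta theta" and ?s = "sin (theta t)" and ?c = "cos (theta t)"
  note fr = frame_cross3[OF assms, folded mu_def]
  have sc: "?s * ?s + ?c * ?c = 1"
    by (metis power2_eq_square sin_cos_squared_add)
  have comps: "gam ?G t = gam F t + lam t *\<^sub>R nu1 F t + eta t *\<^sub>R nu2 F t"
    "nu1 ?G t = ?s *\<^sub>R nu1 F t + ?c *\<^sub>R nu2 F t" "nu2 ?G t = mu F t"
    by (auto simp: gam_def nu1_def nu2_def evolute_def)
  have mu: "mu ?G t = ?c *\<^sub>R nu1 F t - ?s *\<^sub>R nu2 F t"
    unfolding mu_def[of ?G] comps
    by (simp add: cross_add_left cross_mult_left fr)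
  have gam: "(- lam t * ?c + eta t * ?s) * ?c + (- lam t * ?s - eta t * ?c) * ?s = - lam t"
    "- (- lam t * ?c + eta t * ?s) * ?s + (- lam t * ?s - eta t * ?c) * ?c = - eta t"
    using sc by algebra+
  have "gam ?G t + (- lam t * ?c + eta t * ?s) *\<^sub>R mu ?G t + (- lam t * ?s - eta t * ?c) *\<^sub>R nu1 ?G t
    = gam F t + lam t *\<^sub>R nu1 F t + eta t *\<^sub>R nu2 F t
      + ((- lam t * ?c + eta t * ?s) * ?c + (- lam t * ?s - eta t * ?c) * ?s) *\<^sub>R nu1 F t
      + (- (- lam t * ?c + eta t * ?s) * ?s + (- lam t * ?s - eta t * ?c) * ?c) *\<^sub>R nu2 F t"
    unfolding comps mu by (simp add: algebra_simps)
  also have "\<dots> = gam F t" unfolding gam by simp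
  finally have 1: "gam ?G t + (- lam t * ?c + eta t * ?s) *\<^sub>R mu ?G t
    + (- lam t * ?s - eta t * ?c) *\<^sub>R nu1 ?G t = gam F t" .
  have "cos (- theta t) *\<^sub>R mu ?G t - sin (- theta t) *\<^sub>R nu1 ?G t = (?s * ?s) *\<^sub>R nu1 F t + (?c * ?c) *\<^sub>R nu1 F t"
    "sin (- theta t) *\<^sub>R mu ?G t + cos (- theta t) *\<^sub>R nu1 ?G t = (?s * ?s) *\<^sub>R nu2 F t + (?c * ?c) *\<^sub>R nu2 F t"
    unfolding comps mu by (simp_all add: algebra_simps)
  with 1 sc show ?thesis
    unfolding involute_def by (subst frame_map_eq[of F]) (simp flip: scaleR_left_distrib)
qed

theorem theorem6p7:
  fixes I :: "real set"
    and F :: "real \<Rightarrow> (real^3) \<times> (real^3) \<times> (real^3)"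
  assumes "is_interval I" and "interior I \<noteq> {}"
    and "framed_curve I F"
  shows "(\<forall>lamI etaI thetaI :: real \<Rightarrow> real.
            involute_exists I F lamI etaI \<and> smooth_on I thetaI \<longrightarrow>
            (let G = involute F lamI etaI thetaI;
                 lamE = (\<lambda>t. - lamI t * cos (thetaI t) + etaI t * sin (thetaI t));
                 etaE = (\<lambda>t. - lamI t * sin (thetaI t) - etaI t * cos (thetaI t));
                 thetaE = (\<lambda>t. - thetaI t)
             in evolute_exists I G lamE etaE thetaE \<and>
                (\<forall>t\<in>I. evolute G lamE etaE thetaE t = F t)))
       \<and> (\<forall>lamE etaE thetaE :: real \<Rightarrow> real.
            evolute_exists I F lamE etaE thetaE \<longrightarrow>
            (let G = evolute F lamE etaE thetaE;
                 lamI = (\<lambda>t. - lamE t * cos (thetaE t) + etaE t * sin (thetaE t));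
                 etaI = (\<lambda>t. - lamE t * sin (thetaE t) - etaE t * cos (thetaE t))
             in involute_exists I G lamI etaI \<and>
                (let thetaI = (\<lambda>t. - thetaE t)
                 in smooth_on I thetaI \<and>
                    (\<forall>t\<in>I. involute G lamI etaI thetaI t = F t))))"
proof -
  have perfect: "\<forall>t\<in>I. at t within I \<noteq> bot"
    using at_within_interval_neq_bot assms(1,2) by blast
  have Delta: "(nu1 F t, nu2 F t) \<in> Delta" if "t \<in> I" for t
    using framed_curve_Delta assms(3) that .
  have smooth_coeffs:
    "smooth_on I (\<lambda>t. - lam t * cos (theta t) + eta t * sin (theta t))"
    "smooth_on I (\<lambda>t. - lam t * sin (theta t) - eta t * cos (theta t))"
    "smooth_on I (\<lambda>t. - theta t)"
    if "smooth_on I lam" "smooth_on I eta" "smooth_on I theta" for lam eta theta :: "real \<Rightarrow> real"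
    using that perfect by (auto intro!: smooth_on_intros)
  have 1: "evolute_exists I (involute F lam eta theta)
      (\<lambda>t. - lam t * cos (theta t) + eta t * sin (theta t))
      (\<lambda>t. - lam t * sin (theta t) - eta t * cos (theta t)) (\<lambda>t. - theta t)"
    if ex: "involute_exists I F lam eta" and theta: "smooth_on I theta" for lam eta theta
  proof -
    have sm: "smooth_on I lam" "smooth_on I eta"
      using ex by (auto simp: involute_exists_def smooth_on_Pair_iff[OF perfect])
    have G: "framed_curve I (involute F lam eta theta)"
      using ex framed_curve_involute_iff[OF perfect assms(3) sm theta]
      by (simp add: involute_exists_def)
    note coeffs = smooth_coeffs[OF sm theta]
    \<comment> \<open>it coincides with the given framed curve, which yields the evolute condition for free\<close>
    have "framed_curve I (evolute (involute F lam eta theta)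
      (\<lambda>t. - lam t * cos (theta t) + eta t * sin (theta t))
      (\<lambda>t. - lam t * sin (theta t) - eta t * cos (theta t)) (\<lambda>t. - theta t))"
      by (rule framed_curve_cong[OF perfect assms(3)]) (rule evolute_involute[OF Delta])
    with G coeffs show ?thesis
      unfolding evolute_exists_def smooth_on_Pair_iff[OF perfect]
        framed_curve_evolute_iff[OF perfect G coeffs] by blast
  qed
  have 2: "involute_exists I (evolute F lam eta theta)
      (\<lambda>t. - lam t * cos (theta t) + eta t * sin (theta t))
      (\<lambda>t. - lam t * sin (theta t) - eta t * cos (theta t))
      \<and> smooth_on I (\<lambda>t. - theta t)"
    if ex: "evolute_exists I F lam eta theta" for lam eta theta
  proof -
    have sm: "smooth_on I lam" "smooth_on I eta" "smooth_on I theta"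
      using ex by (auto simp: evolute_exists_def smooth_on_Pair_iff[OF perfect])
    have G: "framed_curve I (evolute F lam eta theta)"
      using ex framed_curve_evolute_iff[OF perfect assms(3) sm]
      by (simp add: evolute_exists_def)
    note coeffs = smooth_coeffs[OF sm]
    have "framed_curve I (involute (evolute F lam eta theta)
      (\<lambda>t. - lam t * cos (theta t) + eta t * sin (theta t))
      (\<lambda>t. - lam t * sin (theta t) - eta t * cos (theta t)) (\<lambda>t. - theta t))"
      by (rule framed_curve_cong[OF perfect assms(3)]) (rule involute_evolute[OF Delta])
    with G coeffs show ?thesis
      unfolding involute_exists_def smooth_on_Pair_iff[OF perfect]
        framed_curve_involute_iff[OF perfect G coeffs] by blast
  qed
  show ?thesis
    unfolding Let_def
    using 1 2 evolute_involute[OF Delta] involute_evolute[OF Delta] by blast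
qed

end
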